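(* Let $(C,\Delta,\gamma,\alpha)$ be a post-Hom-Lie coalgebra (with Hom-Lie cobracket $\gamma$). Define $$\tilde\Delta=\Delta+\gamma,\qquad \tilde\gamma=-\gamma .$$ Then $(C,\tilde\Delta,\tilde\gamma,\alpha)$ is a post-Hom-Lie coalgebra (with Hom-Lie cobracket $\tilde\gamma$).
   Context: All vector spaces are over a field $\mathbb{F}$ of characteristic $0$; $I$ is the identity map, $\tau(x\otimes y)=y\otimes x$, $\xi(x\otimes y\otimes z)=y\otimes z\otimes x$, $\xi^2(x\otimes y\otimes z)=z\otimes x\otimes y$. A post-Hom-Lie coalgebra is a vector space $C$ with linear maps $\Delta,\gamma:C\to C\otimes C$ and $\alpha:C\to C$ such that (i) $\gamma=-\tau\circ\gamma$ and $\gamma\circ\alpha=(\alpha\otimes\alpha)\circ\gamma$; (ii) $(1+\xi+\xi^2)\circ(\alpha\otimes\gamma)\circ\gamma=0$; (iii) $(\alpha\otimes\gamma)\circ\Delta-(\Delta\otimes\alpha)\circ\gamma-(\tau\otimes I)\circ(\alpha\otimes\Delta)\circ\gamma=0$; (iv) $(\Delta\otimes\alpha)\circ\Delta-(\alpha\otimes\Delta)\circ\Delta-(\tau\otimes I)\circ(\Delta\otimes\alpha)\circ\Delta+(\tau\otimes I)\circ(\alpha\otimes\Delta)\circ\Delta+(\gamma\otimes\alpha)\circ\Delta=0$. *)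

theory Defs
  imports Complex_Main "HOL-Library.Function_Algebras"
begin

text \<open>
  The tensor powers \<open>C \<otimes> C\<close> and \<open>C \<otimes> C \<otimes> C\<close> of a vector space \<open>C\<close> over a field \<open>F\<close> are realised
  inside the dual of the space of bilinear (trilinear) forms on \<open>C\<close>: the pure tensor \<open>x \<otimes> y\<close> is
  evaluation of bilinear forms at \<open>(x, y)\<close>, and \<open>C \<otimes> C\<close> is the linear span of the pure tensors.
  Over a field this is the usual tensor product, in arbitrary dimension; the lemmas
  \<open>tensor2_universal\<close> and \<open>tensor3_universal\<close> establish the universal property.
  The type of all functionals is only an ambient vector space, with pointwise operations:
  the tensor powers are the subspaces \<open>tensor2_space\<close> and \<open>tensor3_space\<close>.
\<close>

definition fscale :: "'f::field \<Rightarrow> ('b \<Rightarrow> 'f) \<Rightarrow> 'b \<Rightarrow> 'f"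
  where "fscale c t = (\<lambda>B. c * t B)"

interpretation fspace: vector_space fscale
  by unfold_locales (auto simp: fscale_def algebra_simps fun_eq_iff)

type_synonym ('f, 'c) tensor2 = "('c \<Rightarrow> 'c \<Rightarrow> 'f) \<Rightarrow> 'f"
type_synonym ('f, 'c) tensor3 = "('c \<Rightarrow> 'c \<Rightarrow> 'c \<Rightarrow> 'f) \<Rightarrow> 'f"

text \<open>
  Extension of a multilinear map \<open>h\<close> with values in a space of functions to the tensor power;
  characterised by \<open>lift2_tensor2\<close> and \<open>lift3_tensor3\<close>.
\<close>

definition lift2 :: "('c \<Rightarrow> 'c \<Rightarrow> 'b \<Rightarrow> 'f) \<Rightarrow> ('f, 'c) tensor2 \<Rightarrow> 'b \<Rightarrow> 'f"
  where "lift2 h t = (\<lambda>B. t (\<lambda>x y. h x y B))"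

definition lift3 :: "('c \<Rightarrow> 'c \<Rightarrow> 'c \<Rightarrow> 'b \<Rightarrow> 'f) \<Rightarrow> ('f, 'c) tensor3 \<Rightarrow> 'b \<Rightarrow> 'f"
  where "lift3 h t = (\<lambda>B. t (\<lambda>x y z. h x y z B))"

locale tensor_powers = vector_space scale
  for scale :: "'a::field \<Rightarrow> 'b::ab_group_add \<Rightarrow> 'b"  (infixr "*s" 75)
begin

definition bilinear_map :: "('a \<Rightarrow> 'w \<Rightarrow> 'w) \<Rightarrow> ('b \<Rightarrow> 'b \<Rightarrow> 'w::ab_group_add) \<Rightarrow> bool"
  where "bilinear_map s h \<longleftrightarrow>
    (\<forall>x. Vector_Spaces.linear scale s (\<lambda>y. h x y)) \<and>
    (\<forall>y. Vector_Spaces.linear scale s (\<lambda>x. h x y))"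

definition trilinear_map :: "('a \<Rightarrow> 'w \<Rightarrow> 'w) \<Rightarrow> ('b \<Rightarrow> 'b \<Rightarrow> 'b \<Rightarrow> 'w::ab_group_add) \<Rightarrow> bool"
  where "trilinear_map s h \<longleftrightarrow>
    (\<forall>x y. Vector_Spaces.linear scale s (\<lambda>z. h x y z)) \<and>
    (\<forall>x z. Vector_Spaces.linear scale s (\<lambda>y. h x y z)) \<and>
    (\<forall>y z. Vector_Spaces.linear scale s (\<lambda>x. h x y z))"

definition tensor2 :: "'b \<Rightarrow> 'b \<Rightarrow> ('a, 'b) tensor2"  (infix "\<otimes>" 76)
  where "x \<otimes> y = (\<lambda>B. if bilinear_map (*) B then B x y else 0)"

definition tensor3 :: "'b \<Rightarrow> 'b \<Rightarrow> 'b \<Rightarrow> ('a, 'b) tensor3"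
  where "tensor3 x y z = (\<lambda>B. if trilinear_map (*) B then B x y z else 0)"

definition tensor2_space :: "('a, 'b) tensor2 set"
  where "tensor2_space = fspace.span {x \<otimes> y | x y. True}"

definition tensor3_space :: "('a, 'b) tensor3 set"
  where "tensor3_space = fspace.span {tensor3 x y z | x y z. True}"

text \<open>The products \<open>C \<times> (C \<otimes> C) \<rightarrow> C \<otimes> C \<otimes> C\<close> and \<open>(C \<otimes> C) \<times> C \<rightarrow> C \<otimes> C \<otimes> C\<close>.\<close>

definition tensor12 :: "'b \<Rightarrow> ('a, 'b) tensor2 \<Rightarrow> ('a, 'b) tensor3"
  where "tensor12 x = lift2 (\<lambda>y z. tensor3 x y z)"

definition tensor21 :: "('a, 'b) tensor2 \<Rightarrow> 'b \<Rightarrow> ('a, 'b) tensor3"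
  where "tensor21 t z = lift2 (\<lambda>x y. tensor3 x y z) t"

text \<open>
  The map \<open>f \<otimes> g\<close> on \<open>C \<otimes> C\<close>; the digits are the tensor degrees of the values of \<open>f\<close> and \<open>g\<close>.
\<close>

definition map11 :: "('b \<Rightarrow> 'b) \<Rightarrow> ('b \<Rightarrow> 'b) \<Rightarrow> ('a, 'b) tensor2 \<Rightarrow> ('a, 'b) tensor2"
  where "map11 f g = lift2 (\<lambda>x y. f x \<otimes> g y)"

definition map12 :: "('b \<Rightarrow> 'b) \<Rightarrow> ('b \<Rightarrow> ('a, 'b) tensor2) \<Rightarrow> ('a, 'b) tensor2 \<Rightarrow> ('a, 'b) tensor3"
  where "map12 f g = lift2 (\<lambda>x y. tensor12 (f x) (g y))"

definition map21 :: "('b \<Rightarrow> ('a, 'b) tensor2) \<Rightarrow> ('b \<Rightarrow> 'b) \<Rightarrow> ('a, 'b) tensor2 \<Rightarrow> ('a, 'b) tensor3"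
  where "map21 f g = lift2 (\<lambda>x y. tensor21 (f x) (g y))"

definition tau :: "('a, 'b) tensor2 \<Rightarrow> ('a, 'b) tensor2"
  where "tau = lift2 (\<lambda>x y. y \<otimes> x)"

text \<open>\<open>\<tau> \<otimes> I\<close> on \<open>C \<otimes> C \<otimes> C\<close>, acting on the first two factors.\<close>

definition tau_I :: "('a, 'b) tensor3 \<Rightarrow> ('a, 'b) tensor3"
  where "tau_I = lift3 (\<lambda>x y z. tensor21 (tau (x \<otimes> y)) z)"

definition xi :: "('a, 'b) tensor3 \<Rightarrow> ('a, 'b) tensor3"
  where "xi = lift3 (\<lambda>x y z. tensor3 y z x)"

end

text \<open>
  The symbols \<open>+\<close>, \<open>-\<close> and \<open>0\<close> below are the pointwise operations on functions
  (and bind more tightly than \<open>\<circ>\<close>).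
\<close>

locale post_Hom_Lie_coalgebra = tensor_powers scale
  for scale :: "'f::field_char_0 \<Rightarrow> 'c::ab_group_add \<Rightarrow> 'c" +
  fixes \<Delta> \<gamma> :: "'c \<Rightarrow> ('f, 'c) tensor2" and \<alpha> :: "'c \<Rightarrow> 'c"
  assumes linear_\<Delta>: "Vector_Spaces.linear scale fscale \<Delta>" and range_\<Delta>: "range \<Delta> \<subseteq> tensor2_space"
    and linear_\<gamma>: "Vector_Spaces.linear scale fscale \<gamma>" and range_\<gamma>: "range \<gamma> \<subseteq> tensor2_space"
    and linear_\<alpha>: "Vector_Spaces.linear scale scale \<alpha>"
    and skew: "\<gamma> = - (tau \<circ> \<gamma>)"
    and multiplicative: "\<gamma> \<circ> \<alpha> = map11 \<alpha> \<alpha> \<circ> \<gamma>"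
    and Hom_Jacobi: "(id + xi + (xi \<circ> xi)) \<circ> map12 \<alpha> \<gamma> \<circ> \<gamma> = 0"
    and post1: "(map12 \<alpha> \<gamma> \<circ> \<Delta>) - (map21 \<Delta> \<alpha> \<circ> \<gamma>) - (tau_I \<circ> map12 \<alpha> \<Delta> \<circ> \<gamma>) = 0"
    and post2: "(map21 \<Delta> \<alpha> \<circ> \<Delta>) - (map12 \<alpha> \<Delta> \<circ> \<Delta>) - (tau_I \<circ> map21 \<Delta> \<alpha> \<circ> \<Delta>)
      + (tau_I \<circ> map12 \<alpha> \<Delta> \<circ> \<Delta>) + (map21 \<gamma> \<alpha> \<circ> \<Delta>) = 0"

subsection \<open>Universal property\<close>

lemma (in tensor_powers) separating_functional:
  assumes "w \<noteq> 0"
  obtains \<phi> where "Vector_Spaces.linear scale (*) \<phi>" "\<phi> w \<noteq> 0"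
proof -
  interpret F: vector_space "(*) :: 'a \<Rightarrow> 'a \<Rightarrow> 'a"
    by unfold_locales (auto simp: algebra_simps)
  interpret P: vector_space_pair scale "(*) :: 'a \<Rightarrow> 'a \<Rightarrow> 'a" ..
  have "independent {w}" using assms by simp
  from P.linear_independent_extend[OF this, of "\<lambda>_. 1"] that show ?thesis
    by (metis insertI1 zero_neq_one)
qed

text \<open>
  A family \<open>h\<close> extends linearly along a family \<open>p\<close> of functionals
  as soon as every functional of \<open>h\<close> is seen by \<open>p\<close>.
\<close>

lemma (in tensor_powers) extend_along:
  fixes p :: "'i \<Rightarrow> 'x \<Rightarrow> 'a" and h :: "'i \<Rightarrow> 'b"
  assumes "\<And>\<phi>. Vector_Spaces.linear scale (*) \<phi> \<Longrightarrow> \<exists>B. \<forall>i. p i B = \<phi> (h i)"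
  shows "\<exists>L. Vector_Spaces.linear fscale scale L \<and> (\<forall>i. L (p i) = h i)"
proof -
  interpret P: vector_space_pair "fscale :: 'a \<Rightarrow> ('x \<Rightarrow> 'a) \<Rightarrow> 'x \<Rightarrow> 'a" scale ..
  interpret Q: vector_space_pair "fscale :: 'a \<Rightarrow> ('x \<Rightarrow> 'a) \<Rightarrow> 'x \<Rightarrow> 'a" "(*) :: 'a \<Rightarrow> 'a \<Rightarrow> 'a"
    by unfold_locales (auto simp: algebra_simps)
  obtain S where S: "S \<subseteq> range p" "fspace.independent S" "range p \<subseteq> fspace.span S"
    by (rule fspace.maximal_independent_subset)
  define g where "g b = h (inv p b)" for b
  obtain L where L: "Vector_Spaces.linear fscale scale L" "\<forall>b\<in>S. L b = g b"
    using P.linear_independent_extend[OF S(2)] by blast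
  have "L (p i) = h i" for i
  proof (rule ccontr)
    assume "L (p i) \<noteq> h i"
    then obtain \<phi> where \<phi>: "Vector_Spaces.linear scale (*) \<phi>" "\<phi> (L (p i) - h i) \<noteq> 0"
      using separating_functional[of "L (p i) - h i"] by auto
    obtain B where B: "\<And>i. p i B = \<phi> (h i)" using assms[OF \<phi>(1)] by blast
    have 1: "Vector_Spaces.linear fscale (*) (\<lambda>t. \<phi> (L t))"
      using L(1) \<phi>(1) by (simp add: Vector_Spaces.linear_iff)
    have 2: "Vector_Spaces.linear fscale (*) (\<lambda>t. t B :: 'a)"
      using \<phi>(1) fspace.vector_space_axioms by (auto simp: Vector_Spaces.linear_iff fscale_def)
    have 3: "\<phi> (L b) = b B" if "b \<in> S" for b
    proof -
      have "p (inv p b) = b" using that S(1) by (meson f_inv_into_f subsetD)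
      then show ?thesis using L(2) that B[of "inv p b"] by (simp add: g_def)
    qed
    have "\<phi> (L (p i)) = p i B"
      by (rule Q.linear_eq_on[OF 1 2 _ 3]) (use S(3) in auto)
    moreover have "\<phi> (L (p i) - h i) + \<phi> (h i) = \<phi> (L (p i))"
      using \<phi>(1) unfolding Vector_Spaces.linear_iff by (metis diff_add_cancel)
    ultimately have "\<phi> (L (p i) - h i) = 0" using B by simp
    with \<phi>(2) show False by simp
  qed
  with L(1) show ?thesis by blast
qed

context tensor_powers
begin

lemma bilinear_map_tensor2: "bilinear_map fscale (\<otimes>)"
  unfolding bilinear_map_def Vector_Spaces.linear_iff tensor2_def fscale_def[abs_def]
  using vector_space_axioms fspace.vector_space_axioms
  by (auto simp: fun_eq_iff fscale_def[abs_def])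

lemma trilinear_map_tensor3: "trilinear_map fscale tensor3"
  unfolding trilinear_map_def Vector_Spaces.linear_iff tensor3_def fscale_def[abs_def]
  using vector_space_axioms fspace.vector_space_axioms
  by (auto simp: fun_eq_iff fscale_def[abs_def])

lemma tensor2_universal:
  fixes h :: "'b \<Rightarrow> 'b \<Rightarrow> 'w::ab_group_add"
  assumes "vector_space s" "bilinear_map s h"
  shows "\<exists>L. Vector_Spaces.linear fscale s L \<and> (\<forall>x y. L (x \<otimes> y) = h x y)"
    and "\<lbrakk>Vector_Spaces.linear fscale s L; \<forall>x y. L (x \<otimes> y) = h x y;
      Vector_Spaces.linear fscale s L'; \<forall>x y. L' (x \<otimes> y) = h x y; t \<in> tensor2_space\<rbrakk> \<Longrightarrow> L t = L' t"
proof -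
  interpret W: tensor_powers s by (intro tensor_powers.intro) fact
  have "\<exists>B. \<forall>i. (case i of (x, y) \<Rightarrow> x \<otimes> y) B = \<phi> (case i of (x, y) \<Rightarrow> h x y)"
    if "Vector_Spaces.linear s (*) \<phi>" for \<phi>
    using assms(2) that
    by (intro exI[of _ "\<lambda>x y. \<phi> (h x y)"]) (auto simp: tensor2_def bilinear_map_def Vector_Spaces.linear_iff)
  from W.extend_along[OF this]
  show "\<exists>L. Vector_Spaces.linear fscale s L \<and> (\<forall>x y. L (x \<otimes> y) = h x y)" by auto
  interpret P: vector_space_pair "fscale :: 'a \<Rightarrow> ('a, 'b) tensor2 \<Rightarrow> ('a, 'b) tensor2" s ..
  show "L t = L' t" if "Vector_Spaces.linear fscale s L" "\<forall>x y. L (x \<otimes> y) = h x y"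
    "Vector_Spaces.linear fscale s L'" "\<forall>x y. L' (x \<otimes> y) = h x y" "t \<in> tensor2_space"
    by (rule P.linear_eq_on[OF that(1,3) that(5)[unfolded tensor2_space_def]]) (use that in auto)
qed

lemma tensor3_universal:
  fixes h :: "'b \<Rightarrow> 'b \<Rightarrow> 'b \<Rightarrow> 'w::ab_group_add"
  assumes "vector_space s" "trilinear_map s h"
  shows "\<exists>L. Vector_Spaces.linear fscale s L \<and> (\<forall>x y z. L (tensor3 x y z) = h x y z)"
    and "\<lbrakk>Vector_Spaces.linear fscale s L; \<forall>x y z. L (tensor3 x y z) = h x y z;
      Vector_Spaces.linear fscale s L'; \<forall>x y z. L' (tensor3 x y z) = h x y z;
      t \<in> tensor3_space\<rbrakk> \<Longrightarrow> L t = L' t"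
proof -
  interpret W: tensor_powers s by (intro tensor_powers.intro) fact
  have "\<exists>B. \<forall>i. (case i of (x, y, z) \<Rightarrow> tensor3 x y z) B = \<phi> (case i of (x, y, z) \<Rightarrow> h x y z)"
    if "Vector_Spaces.linear s (*) \<phi>" for \<phi>
    using assms(2) that
    by (intro exI[of _ "\<lambda>x y z. \<phi> (h x y z)"]) (auto simp: tensor3_def trilinear_map_def Vector_Spaces.linear_iff)
  from W.extend_along[OF this]
  show "\<exists>L. Vector_Spaces.linear fscale s L \<and> (\<forall>x y z. L (tensor3 x y z) = h x y z)" by auto
  interpret P: vector_space_pair "fscale :: 'a \<Rightarrow> ('a, 'b) tensor3 \<Rightarrow> ('a, 'b) tensor3" s ..
  show "L t = L' t" if "Vector_Spaces.linear fscale s L" "\<forall>x y z. L (tensor3 x y z) = h x y z"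
    "Vector_Spaces.linear fscale s L'" "\<forall>x y z. L' (tensor3 x y z) = h x y z" "t \<in> tensor3_space"
    by (rule P.linear_eq_on[OF that(1,3) that(5)[unfolded tensor3_space_def]]) (use that in auto)
qed

subsection \<open>The maps on pure tensors\<close>

lemma linear_lift2: "Vector_Spaces.linear fscale fscale (lift2 h)"
  by (auto simp: Vector_Spaces.linear_iff fspace.vector_space_axioms)
    (auto simp: lift2_def fscale_def fun_eq_iff)

lemma linear_lift3: "Vector_Spaces.linear fscale fscale (lift3 h)"
  by (auto simp: Vector_Spaces.linear_iff fspace.vector_space_axioms)
    (auto simp: lift3_def fscale_def fun_eq_iff)

lemma linear_apply: "Vector_Spaces.linear scale fscale f \<Longrightarrow> Vector_Spaces.linear scale (*) (\<lambda>x. f x B)"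
  unfolding Vector_Spaces.linear_iff by (auto simp: fscale_def vector_space_def algebra_simps)

lemma bilinear_map_apply: "bilinear_map fscale h \<Longrightarrow> bilinear_map (*) (\<lambda>x y. h x y B)"
  unfolding bilinear_map_def by (auto intro: linear_apply[of "h _"] linear_apply[of "\<lambda>x. h x _"])

lemma trilinear_map_apply: "trilinear_map fscale h \<Longrightarrow> trilinear_map (*) (\<lambda>x y z. h x y z B)"
  unfolding trilinear_map_def
  by (auto intro: linear_apply[of "h _ _"] linear_apply[of "\<lambda>y. h _ y _"] linear_apply[of "\<lambda>x. h x _ _"])

lemma lift2_tensor2: "bilinear_map fscale h \<Longrightarrow> lift2 h (x \<otimes> y) = h x y"
  using bilinear_map_apply[of h] by (auto simp: lift2_def tensor2_def fun_eq_iff)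

lemma lift3_tensor3: "trilinear_map fscale h \<Longrightarrow> lift3 h (tensor3 x y z) = h x y z"
  using trilinear_map_apply[of h] by (auto simp: lift3_def tensor3_def fun_eq_iff)

lemma tensor12_tensor2: "tensor12 x (y \<otimes> z) = tensor3 x y z"
  using trilinear_map_tensor3 unfolding tensor12_def
  by (intro lift2_tensor2) (auto simp: bilinear_map_def trilinear_map_def)

lemma tensor21_tensor2: "tensor21 (x \<otimes> y) z = tensor3 x y z"
  using trilinear_map_tensor3 unfolding tensor21_def
  by (intro lift2_tensor2) (auto simp: bilinear_map_def trilinear_map_def)

lemma tau_tensor2: "tau (x \<otimes> y) = y \<otimes> x"
  using bilinear_map_tensor2 unfolding tau_def
  by (intro lift2_tensor2) (auto simp: bilinear_map_def)

lemma tau_I_tensor3: "tau_I (tensor3 x y z) = tensor3 y x z"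
  using trilinear_map_tensor3 unfolding tau_I_def tau_tensor2 tensor21_tensor2
  by (intro lift3_tensor3) (auto simp: trilinear_map_def)

lemma xi_tensor3: "xi (tensor3 x y z) = tensor3 y z x"
  using trilinear_map_tensor3 unfolding xi_def
  by (intro lift3_tensor3) (auto simp: trilinear_map_def)

lemma map11_tensor2:
  assumes "Vector_Spaces.linear scale scale f" "Vector_Spaces.linear scale scale g"
  shows "map11 f g (x \<otimes> y) = f x \<otimes> g y"
  using bilinear_map_tensor2 assms unfolding map11_def
  by (intro lift2_tensor2) (auto simp: bilinear_map_def Vector_Spaces.linear_iff)

lemma tensor2_space_add:
  assumes "t \<in> tensor2_space" "bilinear_map (*) A" "bilinear_map (*) B"
  shows "t (\<lambda>x y. A x y + B x y) = t A + t B"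
proof -
  have "bilinear_map (*) (\<lambda>x y. A x y + B x y)"
    using assms(2,3) by (auto simp: bilinear_map_def Vector_Spaces.linear_iff algebra_simps)
  with assms show ?thesis unfolding tensor2_space_def
    by (induction rule: fspace.span_induct_alt) (auto simp: tensor2_def fscale_def algebra_simps)
qed

lemma tensor2_space_scale:
  assumes "t \<in> tensor2_space" "bilinear_map (*) B"
  shows "t (\<lambda>x y. c * B x y) = c * t B"
proof -
  have "bilinear_map (*) (\<lambda>x y. c * B x y)"
    using assms(2) by (auto simp: bilinear_map_def Vector_Spaces.linear_iff algebra_simps)
  with assms show ?thesis unfolding tensor2_space_def
    by (induction rule: fspace.span_induct_alt) (auto simp: tensor2_def fscale_def algebra_simps)
qed

lemma bilinear_map_tensor3:
  "bilinear_map (*) (\<lambda>y z. tensor3 x y z B)" "bilinear_map (*) (\<lambda>y z. tensor3 y z x B)"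
  using trilinear_map_tensor3
  by (auto simp: bilinear_map_def trilinear_map_def intro!: linear_apply[where f = "tensor3 _ _"]
      linear_apply[where f = "\<lambda>y. tensor3 _ y _"] linear_apply[where f = "\<lambda>x. tensor3 x _ _"])

lemma tensor3_add:
  "tensor3 (x + x') y z B = tensor3 x y z B + tensor3 x' y z B"
  "tensor3 x y (z + z') B = tensor3 x y z B + tensor3 x y z' B"
  "tensor3 (c *s x) y z B = c * tensor3 x y z B"
  "tensor3 x y (c *s z) B = c * tensor3 x y z B"
  using trilinear_map_tensor3 by (simp_all add: trilinear_map_def Vector_Spaces.linear_iff fscale_def)

lemma linear_tensor12_right: "Vector_Spaces.linear fscale fscale (tensor12 x)"
  unfolding tensor12_def by (rule linear_lift2)

lemma linear_tensor21_left: "Vector_Spaces.linear fscale fscale (\<lambda>t. tensor21 t z)"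
  unfolding tensor21_def by (rule linear_lift2)

lemma linear_tensor12_left:
  assumes "t \<in> tensor2_space"
  shows "Vector_Spaces.linear scale fscale (\<lambda>x. tensor12 x t)"
  unfolding Vector_Spaces.linear_iff using vector_space_axioms fspace.vector_space_axioms
  by (auto simp: tensor12_def lift2_def tensor3_add fscale_def fun_eq_iff
      tensor2_space_add[OF assms] tensor2_space_scale[OF assms] bilinear_map_tensor3)

lemma linear_tensor21_right:
  assumes "t \<in> tensor2_space"
  shows "Vector_Spaces.linear scale fscale (tensor21 t)"
  unfolding Vector_Spaces.linear_iff using vector_space_axioms fspace.vector_space_axioms
  by (auto simp: tensor21_def lift2_def tensor3_add fscale_def fun_eq_iff
      tensor2_space_add[OF assms] tensor2_space_scale[OF assms] bilinear_map_tensor3)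

lemma map12_tensor2:
  assumes "Vector_Spaces.linear scale scale f" "Vector_Spaces.linear scale fscale g"
    and "range g \<subseteq> tensor2_space"
  shows "map12 f g (x \<otimes> y) = tensor12 (f x) (g y)"
proof -
  have "Vector_Spaces.linear scale fscale (\<lambda>y. tensor12 (f x) (g y))" for x
    using assms(2) linear_tensor12_right[of "f x"] unfolding Vector_Spaces.linear_iff
    by (simp add: fspace.vector_space_axioms)
  moreover have "Vector_Spaces.linear scale fscale (\<lambda>x. tensor12 (f x) (g y))" for y
    using assms(1) linear_tensor12_left[of "g y"] assms(3) unfolding Vector_Spaces.linear_iff by auto
  ultimately show ?thesis unfolding map12_def
    by (intro lift2_tensor2) (simp add: bilinear_map_def)
qed

lemma map21_tensor2:
  assumes "Vector_Spaces.linear scale fscale f" "Vector_Spaces.linear scale scale g"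
    and "range f \<subseteq> tensor2_space"
  shows "map21 f g (x \<otimes> y) = tensor21 (f x) (g y)"
proof -
  have "Vector_Spaces.linear scale fscale (\<lambda>x. tensor21 (f x) (g y))" for y
    using assms(1) linear_tensor21_left[of "g y"] unfolding Vector_Spaces.linear_iff
    by (simp add: fspace.vector_space_axioms)
  moreover have "Vector_Spaces.linear scale fscale (\<lambda>y. tensor21 (f x) (g y))" for x
    using assms(2) linear_tensor21_right[of "f x"] assms(3) unfolding Vector_Spaces.linear_iff by auto
  ultimately show ?thesis unfolding map21_def
    by (intro lift2_tensor2) (simp add: bilinear_map_def)
qed

end

end

theory Submission
  imports Defs
begin

text \<open>
  By skew-symmetry \<open>(\<gamma> \<otimes> \<alpha>) \<gamma> = - \<xi> (\<alpha> \<otimes> \<gamma>) \<gamma>\<close> and \<open>(\<tau> \<otimes> I) (\<alpha> \<otimes> \<gamma>) \<gamma> = - \<xi>\<^sup>2 (\<alpha> \<otimes> \<gamma>) \<gamma>\<close>, so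
  the Hom-Jacobi identity reads \<open>(\<gamma> \<otimes> \<alpha>) \<gamma> = (\<alpha> \<otimes> \<gamma>) \<gamma> - (\<tau> \<otimes> I) (\<alpha> \<otimes> \<gamma>) \<gamma>\<close>. This
  is exactly the discrepancy between the old and the new compatibility condition (iii). In (iv) the
  terms quadratic in \<open>\<gamma>\<close> cancel for the same reason, and the remaining mixed terms are (iii)
  plus its image under the involution \<open>\<tau> \<otimes> I\<close>.
\<close>

section \<open>Linearity on the tensor powers and reduction to pure tensors\<close>

context tensor_powers
begin

lemma linear_compose_fscale:
  assumes "Vector_Spaces.linear fscale fscale L" "Vector_Spaces.linear fscale fscale M"
  shows "Vector_Spaces.linear fscale fscale (\<lambda>t. M (L t))"
  using Vector_Spaces.linear_compose[OF assms] by (simp add: comp_def)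

lemma linear_add_fscale:
  assumes "Vector_Spaces.linear fscale fscale L" "Vector_Spaces.linear fscale fscale M"
  shows "Vector_Spaces.linear fscale fscale (\<lambda>t. L t + M t)"
  using assms by (simp add: Vector_Spaces.linear_iff fspace.scale_right_distrib)

lemma linear_uminus_fscale:
  assumes "Vector_Spaces.linear fscale fscale L"
  shows "Vector_Spaces.linear fscale fscale (\<lambda>t. - L t)"
  using assms by (simp add: Vector_Spaces.linear_iff fspace.scale_minus_right)

lemma linear_map11: "Vector_Spaces.linear fscale fscale (map11 f g)"
  unfolding map11_def by (rule linear_lift2)

lemma linear_map12: "Vector_Spaces.linear fscale fscale (map12 f g)"
  unfolding map12_def by (rule linear_lift2)

lemma linear_map21: "Vector_Spaces.linear fscale fscale (map21 f g)"
  unfolding map21_def by (rule linear_lift2)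

lemma linear_tau: "Vector_Spaces.linear fscale fscale tau"
  unfolding tau_def by (rule linear_lift2)

lemma linear_tau_I: "Vector_Spaces.linear fscale fscale tau_I"
  unfolding tau_I_def by (rule linear_lift3)

lemma linear_xi: "Vector_Spaces.linear fscale fscale xi"
  unfolding xi_def by (rule linear_lift3)

lemmas linear_tensor_maps = linear_map11 linear_map12 linear_map21 linear_tau linear_tau_I linear_xi

lemma linear_fscale_simps:
  assumes "Vector_Spaces.linear fscale fscale L"
  shows "L (s + t) = L s + L t" "L (s - t) = L s - L t" "L (- t) = - L t"
proof -
  interpret Vector_Spaces.linear fscale fscale L by fact
  show "L (s + t) = L s + L t" "L (s - t) = L s - L t" "L (- t) = - L t"
    by (simp_all add: add diff neg)
qed

lemmas tensor_map_simps = linear_tensor_maps[THEN linear_fscale_simps(1)]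
  linear_tensor_maps[THEN linear_fscale_simps(2)] linear_tensor_maps[THEN linear_fscale_simps(3)]

text \<open>The ambient type of all functionals is larger than the tensor power, so identities
  between linear maps are checked on pure tensors and carried only to their span.\<close>

lemma linear_eq_on_tensor2_space:
  fixes L M :: "('a, 'b) tensor2 \<Rightarrow> 'x \<Rightarrow> 'a"
  assumes "t \<in> tensor2_space"
    and "Vector_Spaces.linear fscale fscale L" "Vector_Spaces.linear fscale fscale M"
    and "\<And>x y. L (x \<otimes> y) = M (x \<otimes> y)"
  shows "L t = M t"
proof -
  interpret vector_space_pair "fscale :: 'a \<Rightarrow> ('a, 'b) tensor2 \<Rightarrow> ('a, 'b) tensor2"
    "fscale :: 'a \<Rightarrow> ('x \<Rightarrow> 'a) \<Rightarrow> 'x \<Rightarrow> 'a" ..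
  show ?thesis
    by (rule linear_eq_on[OF assms(2,3) assms(1)[unfolded tensor2_space_def]]) (use assms(4) in auto)
qed

lemma linear_eq_on_tensor3_space:
  fixes L M :: "('a, 'b) tensor3 \<Rightarrow> 'x \<Rightarrow> 'a"
  assumes "t \<in> tensor3_space"
    and "Vector_Spaces.linear fscale fscale L" "Vector_Spaces.linear fscale fscale M"
    and "\<And>x y z. L (tensor3 x y z) = M (tensor3 x y z)"
  shows "L t = M t"
proof -
  interpret vector_space_pair "fscale :: 'a \<Rightarrow> ('a, 'b) tensor3 \<Rightarrow> ('a, 'b) tensor3"
    "fscale :: 'a \<Rightarrow> ('x \<Rightarrow> 'a) \<Rightarrow> 'x \<Rightarrow> 'a" ..
  show ?thesis
    by (rule linear_eq_on[OF assms(2,3) assms(1)[unfolded tensor3_space_def]]) (use assms(4) in auto)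
qed

lemma linear_image_tensor2_space:
  assumes "t \<in> tensor2_space" "Vector_Spaces.linear fscale fscale L"
    and "\<And>x y. L (x \<otimes> y) \<in> fspace.span S"
  shows "L t \<in> fspace.span S"
proof -
  interpret Vector_Spaces.linear fscale fscale L by fact
  from assms(1) show ?thesis unfolding tensor2_space_def
  proof (induction rule: fspace.span_induct_alt)
    case base
    show ?case unfolding zero by (rule fspace.span_zero)
  next
    case (step c x y)
    then have "L x \<in> fspace.span S" using assms(3) by auto
    then show ?case unfolding add scale by (intro fspace.span_add fspace.span_scale step)
  qed
qed

lemma tensor12_in_tensor3_space:
  assumes "t \<in> tensor2_space"
  shows "tensor12 x t \<in> tensor3_space"
  unfolding tensor3_space_def
  by (rule linear_image_tensor2_space[OF assms linear_tensor12_right])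
    (auto simp: tensor12_tensor2 intro!: fspace.span_base)

text \<open>Makes the involution law for \<open>tau_I\<close> applicable to terms such as
  \<open>map12 \<alpha> \<Delta> (\<gamma> c)\<close>.\<close>

lemma map12_in_tensor3_space:
  assumes "Vector_Spaces.linear scale scale f" "Vector_Spaces.linear scale fscale g"
    and "range g \<subseteq> tensor2_space" "t \<in> tensor2_space"
  shows "map12 f g t \<in> tensor3_space"
proof -
  have "map12 f g (x \<otimes> y) \<in> fspace.span {tensor3 x y z | x y z. True}" for x y
    using tensor12_in_tensor3_space[of "g y" "f x"] assms(3)
    by (auto simp: map12_tensor2[OF assms(1-3)] tensor3_space_def)
  then show ?thesis unfolding tensor3_space_def
    by (rule linear_image_tensor2_space[OF assms(4) linear_map12])
qed

text \<open>Swapping two factors twice fixes every pure tensor. At a form that is not trilinear,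
  \<open>tau_I t\<close> takes the value of \<open>t\<close> at the zero form, so the law can fail
  outside \<open>tensor3_space\<close>.\<close>

lemma tau_I_tau_I:
  assumes "t \<in> tensor3_space"
  shows "tau_I (tau_I t) = t"
  by (rule linear_eq_on_tensor3_space[OF assms, where M = "\<lambda>t. t"])
    (auto simp: tau_I_tensor3 linear_compose_fscale[OF linear_tau_I linear_tau_I] fspace.linear_ident)

section \<open>The flip and the cyclic rotation on products of a vector and a 2-tensor\<close>

lemma tau_I_tensor21:
  assumes "t \<in> tensor2_space"
  shows "tau_I (tensor21 t z) = tensor21 (tau t) z"
  by (rule linear_eq_on_tensor2_space[OF assms])
    (auto simp: tau_I_tensor3 tensor21_tensor2 tau_tensor2
      intro: linear_compose_fscale[OF linear_tensor21_left linear_tau_I]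
        linear_compose_fscale[OF linear_tau linear_tensor21_left])

lemma xi_tensor12:
  assumes "t \<in> tensor2_space"
  shows "xi (tensor12 x t) = tensor21 t x"
  by (rule linear_eq_on_tensor2_space[OF assms])
    (auto simp: xi_tensor3 tensor12_tensor2 tensor21_tensor2
      intro: linear_compose_fscale[OF linear_tensor12_right linear_xi] linear_tensor21_left)

text \<open>Exchanging the first two factors is exchanging the last two and then rotating twice:
  \<open>x, y, z\<close> goes to \<open>x, z, y\<close>, then \<open>z, y, x\<close>, then
  \<open>y, x, z\<close>. The flip becomes a \<open>tau\<close> on the 2-tensor alone, where
  skew-symmetry applies.\<close>

lemma tau_I_tensor12:
  assumes "t \<in> tensor2_space"
  shows "tau_I (tensor12 x t) = xi (xi (tensor12 x (tau t)))"
  by (rule linear_eq_on_tensor2_space[OF assms])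
    (auto simp: xi_tensor3 tau_I_tensor3 tensor12_tensor2 tau_tensor2
      intro!: linear_compose_fscale[OF linear_tensor12_right linear_tau_I]
        linear_compose_fscale[OF linear_compose_fscale[OF linear_compose_fscale
          [OF linear_tau linear_tensor12_right] linear_xi] linear_xi])

section \<open>Sums and negatives of cooperations\<close>

lemma linear_into_fscale_add:
  assumes "Vector_Spaces.linear scale fscale f" "Vector_Spaces.linear scale fscale g"
  shows "Vector_Spaces.linear scale fscale (f + g)"
  using assms by (simp add: Vector_Spaces.linear_iff fspace.scale_right_distrib)

lemma linear_into_fscale_uminus:
  assumes "Vector_Spaces.linear scale fscale f"
  shows "Vector_Spaces.linear scale fscale (- f)"
  using assms by (simp add: Vector_Spaces.linear_iff fspace.scale_minus_right)

lemma range_add_tensor2_space: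
  assumes "range f \<subseteq> tensor2_space" "range g \<subseteq> tensor2_space"
  shows "range (f + g) \<subseteq> tensor2_space"
  using assms by (auto simp: tensor2_space_def image_subset_iff intro!: fspace.span_add)

lemma range_uminus_tensor2_space:
  assumes "range f \<subseteq> tensor2_space"
  shows "range (- f) \<subseteq> tensor2_space"
  using assms by (auto simp: tensor2_space_def image_subset_iff intro!: fspace.span_neg)

text \<open>This is additivity in the cooperation, not in the tensor argument. An arbitrary
  functional need not be additive on bilinear forms, so the identity is derived from pure tensors,
  where \<open>tensor12\<close> is linear in its second argument.\<close>

lemma map12_add:
  assumes a: "Vector_Spaces.linear scale scale a"
    and f: "Vector_Spaces.linear scale fscale f" "range f \<subseteq> tensor2_space"
    and g: "Vector_Spaces.linear scale fscale g" "range g \<subseteq> tensor2_space"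
    and t: "t \<in> tensor2_space"
  shows "map12 a (f + g) t = map12 a f t + map12 a g t"
proof (rule linear_eq_on_tensor2_space[OF t linear_map12 linear_add_fscale[OF linear_map12 linear_map12]])
  show "map12 a (f + g) (x \<otimes> y) = map12 a f (x \<otimes> y) + map12 a g (x \<otimes> y)" for x y
    using map12_tensor2[OF a linear_into_fscale_add[OF f(1) g(1)] range_add_tensor2_space[OF f(2) g(2)]]
    by (simp add: map12_tensor2 a f g linear_fscale_simps(1)[OF linear_tensor12_right])
qed

lemma map21_add:
  assumes a: "Vector_Spaces.linear scale scale a"
    and f: "Vector_Spaces.linear scale fscale f" "range f \<subseteq> tensor2_space"
    and g: "Vector_Spaces.linear scale fscale g" "range g \<subseteq> tensor2_space"
    and t: "t \<in> tensor2_space"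
  shows "map21 (f + g) a t = map21 f a t + map21 g a t"
proof (rule linear_eq_on_tensor2_space[OF t linear_map21 linear_add_fscale[OF linear_map21 linear_map21]])
  show "map21 (f + g) a (x \<otimes> y) = map21 f a (x \<otimes> y) + map21 g a (x \<otimes> y)" for x y
    using map21_tensor2[OF linear_into_fscale_add[OF f(1) g(1)] a range_add_tensor2_space[OF f(2) g(2)]]
    by (simp add: map21_tensor2 a f g linear_fscale_simps(1)[OF linear_tensor21_left])
qed

section \<open>Negation, rotation and skew-symmetry for a single cooperation\<close>

context
  fixes a :: "'b \<Rightarrow> 'b" and g :: "'b \<Rightarrow> ('a, 'b) tensor2"
  assumes a: "Vector_Spaces.linear scale scale a"
    and g: "Vector_Spaces.linear scale fscale g" "range g \<subseteq> tensor2_space"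
begin

lemma map12_uminus:
  assumes "t \<in> tensor2_space"
  shows "map12 a (- g) t = - map12 a g t"
proof (rule linear_eq_on_tensor2_space[OF assms linear_map12 linear_uminus_fscale[OF linear_map12]])
  show "map12 a (- g) (x \<otimes> y) = - map12 a g (x \<otimes> y)" for x y
    using map12_tensor2[OF a linear_into_fscale_uminus[OF g(1)] range_uminus_tensor2_space[OF g(2)]]
    by (simp add: map12_tensor2 a g linear_fscale_simps(3)[OF linear_tensor12_right])
qed

lemma map21_uminus:
  assumes "t \<in> tensor2_space"
  shows "map21 (- g) a t = - map21 g a t"
proof (rule linear_eq_on_tensor2_space[OF assms linear_map21 linear_uminus_fscale[OF linear_map21]])
  show "map21 (- g) a (x \<otimes> y) = - map21 g a (x \<otimes> y)" for x y
    using map21_tensor2[OF linear_into_fscale_uminus[OF g(1)] a range_uminus_tensor2_space[OF g(2)]]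
    by (simp add: map21_tensor2 a g linear_fscale_simps(3)[OF linear_tensor21_left])
qed

text \<open>On \<open>x \<otimes> y\<close> both sides are \<open>tensor21 (g y) (a x)\<close>:
  flipping the input puts the split factor first, and so does rotating the output.\<close>

lemma map21_tau:
  assumes "t \<in> tensor2_space"
  shows "map21 g a (tau t) = xi (map12 a g t)"
proof (rule linear_eq_on_tensor2_space[OF assms linear_compose_fscale[OF linear_tau linear_map21]
      linear_compose_fscale[OF linear_map12 linear_xi]])
  have "g y \<in> tensor2_space" for y using g(2) by auto
  then show "map21 g a (tau (x \<otimes> y)) = xi (map12 a g (x \<otimes> y))" for x y
    by (simp add: map12_tensor2 map21_tensor2 tau_tensor2 xi_tensor12 a g)
qed

text \<open>The flip touches only the two factors coming from \<open>g x\<close>, where skewness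
  gives the sign.\<close>

lemma tau_I_map21_skew:
  assumes "t \<in> tensor2_space" "\<And>x. tau (g x) = - g x"
  shows "tau_I (map21 g a t) = - map21 g a t"
proof (rule linear_eq_on_tensor2_space[OF assms(1) linear_compose_fscale[OF linear_map21 linear_tau_I]
      linear_uminus_fscale[OF linear_map21]])
  have "g y \<in> tensor2_space" for y using g(2) by auto
  then show "tau_I (map21 g a (x \<otimes> y)) = - map21 g a (x \<otimes> y)" for x y
    by (simp add: map21_tensor2 tau_I_tensor21 a g assms(2) linear_fscale_simps[OF linear_tensor21_left])
qed

text \<open>Here the flip mixes \<open>a x\<close> with a factor of \<open>g y\<close>;
  \<open>tau_I_tensor12\<close> trades it for two rotations and \<open>tau (g y)\<close>, whose
  skewness gives the sign.\<close>

lemma tau_I_map12_skew: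
  assumes "t \<in> tensor2_space" "\<And>x. tau (g x) = - g x"
  shows "tau_I (map12 a g t) = - xi (xi (map12 a g t))"
proof (rule linear_eq_on_tensor2_space[OF assms(1) linear_compose_fscale[OF linear_map12 linear_tau_I]
      linear_uminus_fscale[OF linear_compose_fscale[OF linear_compose_fscale[OF linear_map12 linear_xi] linear_xi]]])
  have "g y \<in> tensor2_space" for y using g(2) by auto
  then show "tau_I (map12 a g (x \<otimes> y)) = - xi (xi (map12 a g (x \<otimes> y)))" for x y
    by (simp add: map12_tensor2 tau_I_tensor12 a g assms(2) tensor_map_simps
        linear_fscale_simps[OF linear_tensor12_right])
qed

end

end

section \<open>Pointwise identities and the new structure\<close>

context post_Hom_Lie_coalgebra
begin

lemma in_tensor2_space: "\<Delta> c \<in> tensor2_space" "\<gamma> c \<in> tensor2_space"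
  using range_\<Delta> range_\<gamma> by auto

lemma tau_\<gamma>: "tau (\<gamma> c) = - \<gamma> c"
  using fun_cong[OF skew, of c] by (metis comp_apply uminus_apply minus_minus)

lemma Hom_Jacobi_map21:
  "map21 \<gamma> \<alpha> (\<gamma> c) = map12 \<alpha> \<gamma> (\<gamma> c) - tau_I (map12 \<alpha> \<gamma> (\<gamma> c))"
proof -
  \<comment> \<open>Skewness enters through the outer cobracket: the input \<open>\<gamma> c\<close>
    is \<open>- tau (\<gamma> c)\<close>.\<close>
  have "map21 \<gamma> \<alpha> (\<gamma> c) = - xi (map12 \<alpha> \<gamma> (\<gamma> c))"
    using map21_tau[OF linear_\<alpha> linear_\<gamma> range_\<gamma> in_tensor2_space(2)[of c]]
    by (metis tau_\<gamma> linear_fscale_simps(3)[OF linear_map21] minus_minus)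
  \<comment> \<open>Skewness enters through the values of the inner \<open>\<gamma>\<close>.\<close>
  moreover have "tau_I (map12 \<alpha> \<gamma> (\<gamma> c)) = - xi (xi (map12 \<alpha> \<gamma> (\<gamma> c)))"
    by (rule tau_I_map12_skew[OF linear_\<alpha> linear_\<gamma> range_\<gamma> in_tensor2_space(2) tau_\<gamma>])
  moreover have "map12 \<alpha> \<gamma> (\<gamma> c) + xi (map12 \<alpha> \<gamma> (\<gamma> c)) + xi (xi (map12 \<alpha> \<gamma> (\<gamma> c))) = 0"
    using fun_cong[OF Hom_Jacobi, of c] by simp
  ultimately show ?thesis by (simp add: neg_eq_iff_add_eq_0 ac_simps)
qed

lemma post1_apply:
  "map12 \<alpha> \<gamma> (\<Delta> c) = map21 \<Delta> \<alpha> (\<gamma> c) + tau_I (map12 \<alpha> \<Delta> (\<gamma> c))"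
  using fun_cong[OF post1, of c] by (simp add: algebra_simps)

text \<open>Apply \<open>tau_I\<close> to \<open>post1_apply\<close>; the two flips on its last term
  cancel because that term lies in \<open>tensor3_space\<close>.\<close>

lemma post1_tau_I:
  "tau_I (map12 \<alpha> \<gamma> (\<Delta> c)) = tau_I (map21 \<Delta> \<alpha> (\<gamma> c)) + map12 \<alpha> \<Delta> (\<gamma> c)"
  by (simp add: post1_apply tensor_map_simps tau_I_tau_I
      map12_in_tensor3_space linear_\<alpha> linear_\<Delta> range_\<Delta> in_tensor2_space)

lemma post2_apply:
  "map21 \<Delta> \<alpha> (\<Delta> c) - map12 \<alpha> \<Delta> (\<Delta> c) - tau_I (map21 \<Delta> \<alpha> (\<Delta> c))
    + tau_I (map12 \<alpha> \<Delta> (\<Delta> c)) + map21 \<gamma> \<alpha> (\<Delta> c) = 0"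
  using fun_cong[OF post2, of c] by simp

lemmas map_add = map12_add[OF linear_\<alpha> linear_\<Delta> range_\<Delta> linear_\<gamma> range_\<gamma>]
  map21_add[OF linear_\<alpha> linear_\<Delta> range_\<Delta> linear_\<gamma> range_\<gamma>]

lemmas map_uminus = map12_uminus[OF linear_\<alpha> linear_\<gamma> range_\<gamma>]
  map21_uminus[OF linear_\<alpha> linear_\<gamma> range_\<gamma>]

lemmas tau_I_map21_\<gamma> =
  tau_I_map21_skew[OF linear_\<alpha> linear_\<gamma> range_\<gamma> _ tau_\<gamma>]

lemma post_Hom_Lie_coalgebra_dual: "post_Hom_Lie_coalgebra scale (\<Delta> + \<gamma>) (- \<gamma>) \<alpha>"
proof (intro post_Hom_Lie_coalgebra.intro tensor_powers_axioms post_Hom_Lie_coalgebra_axioms.intro)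
  show "Vector_Spaces.linear scale fscale (\<Delta> + \<gamma>)" "range (\<Delta> + \<gamma>) \<subseteq> tensor2_space"
    by (intro linear_into_fscale_add range_add_tensor2_space linear_\<Delta> linear_\<gamma> range_\<Delta> range_\<gamma>)+
  show "Vector_Spaces.linear scale fscale (- \<gamma>)" "range (- \<gamma>) \<subseteq> tensor2_space"
    by (intro linear_into_fscale_uminus range_uminus_tensor2_space linear_\<gamma> range_\<gamma>)+
  show "Vector_Spaces.linear scale scale \<alpha>" by (rule linear_\<alpha>)
  show "- \<gamma> = - (tau \<circ> - \<gamma>)"
    by (rule ext) (simp add: tensor_map_simps tau_\<gamma>)
  show "- \<gamma> \<circ> \<alpha> = map11 \<alpha> \<alpha> \<circ> - \<gamma>"
  proof
    show "(- \<gamma> \<circ> \<alpha>) c = (map11 \<alpha> \<alpha> \<circ> - \<gamma>) c" for c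
      using fun_cong[OF multiplicative, of c] by (simp add: tensor_map_simps)
  qed
  \<comment> \<open>The identity is quadratic in \<open>\<gamma>\<close>, so the two signs
    cancel.\<close>
  show "(id + xi + (xi \<circ> xi)) \<circ> map12 \<alpha> (- \<gamma>) \<circ> - \<gamma> = 0"
  proof
    show "((id + xi + (xi \<circ> xi)) \<circ> map12 \<alpha> (- \<gamma>) \<circ> - \<gamma>) c = 0 c" for c
      using fun_cong[OF Hom_Jacobi, of c] by (simp add: tensor_map_simps map_uminus in_tensor2_space)
  qed
  \<comment> \<open>The terms with one \<open>\<Delta>\<close> add up to the negative of the old
    (iii); those quadratic in \<open>\<gamma>\<close> vanish by
    \<open>Hom_Jacobi_map21\<close>.\<close>
  show "(map12 \<alpha> (- \<gamma>) \<circ> (\<Delta> + \<gamma>)) - (map21 (\<Delta> + \<gamma>) \<alpha> \<circ> - \<gamma>) - (tau_I \<circ> map12 \<alpha> (\<Delta> + \<gamma>) \<circ> - \<gamma>) = 0"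
    by (rule ext) (simp add: tensor_map_simps map_add map_uminus in_tensor2_space
        Hom_Jacobi_map21 post1_apply)
  show "(map21 (\<Delta> + \<gamma>) \<alpha> \<circ> (\<Delta> + \<gamma>)) - (map12 \<alpha> (\<Delta> + \<gamma>) \<circ> (\<Delta> + \<gamma>))
      - (tau_I \<circ> map21 (\<Delta> + \<gamma>) \<alpha> \<circ> (\<Delta> + \<gamma>)) + (tau_I \<circ> map12 \<alpha> (\<Delta> + \<gamma>) \<circ> (\<Delta> + \<gamma>))
      + (map21 (- \<gamma>) \<alpha> \<circ> (\<Delta> + \<gamma>)) = 0"
  proof
    fix c
    \<comment> \<open>In the expansion below \<open>map21 \<gamma> \<alpha> (\<gamma> c)\<close> has
      coefficients 1, 1 and -1, one of them from \<open>tau_I_map21_\<gamma>\<close>. The copy left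
      over cancels against this form of Hom-Jacobi.\<close>
    have J: "tau_I (map12 \<alpha> \<gamma> (\<gamma> c)) = map12 \<alpha> \<gamma> (\<gamma> c) - map21 \<gamma> \<alpha> (\<gamma> c)"
      by (simp add: Hom_Jacobi_map21)
    \<comment> \<open>\<open>post2_apply\<close> cancels the terms quadratic in
      \<open>\<Delta>\<close> together with the one net copy of
      \<open>map21 \<gamma> \<alpha> (\<Delta> c)\<close>. \<open>post1_apply\<close> waits for a
      second simplification: used earlier, it would rewrite the argument of \<open>tau_I\<close>
      before \<open>post1_tau_I\<close> could match.\<close>
    show "((map21 (\<Delta> + \<gamma>) \<alpha> \<circ> (\<Delta> + \<gamma>)) - (map12 \<alpha> (\<Delta> + \<gamma>) \<circ> (\<Delta> + \<gamma>))
      - (tau_I \<circ> map21 (\<Delta> + \<gamma>) \<alpha> \<circ> (\<Delta> + \<gamma>)) + (tau_I \<circ> map12 \<alpha> (\<Delta> + \<gamma>) \<circ> (\<Delta> + \<gamma>))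
      + (map21 (- \<gamma>) \<alpha> \<circ> (\<Delta> + \<gamma>))) c = 0 c"
      using post2_apply[of c]
      by (simp add: tensor_map_simps map_add map_uminus in_tensor2_space tau_I_map21_\<gamma>
          post1_tau_I J) (simp add: post1_apply algebra_simps)
  qed
qed

end

theorem proposition4p9:
  fixes scale :: "'f::field_char_0 \<Rightarrow> 'c::ab_group_add \<Rightarrow> 'c"
    and \<Delta> \<gamma> :: "'c \<Rightarrow> ('f, 'c) tensor2" and \<alpha> :: "'c \<Rightarrow> 'c"
  assumes "post_Hom_Lie_coalgebra scale \<Delta> \<gamma> \<alpha>"
  shows "post_Hom_Lie_coalgebra scale (\<Delta> + \<gamma>) (- \<gamma>) \<alpha>"
  using assms by (rule post_Hom_Lie_coalgebra.post_Hom_Lie_coalgebra_dual)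

end
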